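(* Let $n \ge 1$. Let $\mathcal H_{2n-1}$ be the real hyperplane arrangement in $\mathbb{R}^{2n+2}$ (coordinates $x_1,\dots,x_{n+1},y_1,\dots,y_{n+1}$) given by $$\mathcal{H}_{2n-1}= \{x_i - x_j = y_i : 1 \le i < j \le n+1\}.$$ Let $\Gamma_{2n}$ be the bipartite graph on vertex set $\{1,3,\dots,2n-1\}\sqcup\{2,4,\dots,2n\}$ in which $2i-1$ and $2j$ are adjacent if and only if $i \le j$. Then the intersection lattice $\mathcal L(\mathcal H_{2n-1})$ is isomorphic to the bond lattice $\Pi_{\Gamma_{2n}}$, and $\Pi_{\Gamma_{2n}}$ is equal to the induced subposet of the partition lattice $\Pi_{2n}$ consisting of those partitions $B_1|\cdots|B_k$ of $[2n]$ such that $\min(B_i)$ is odd and $\max(B_i)$ is even for every nonsingleton block $B_i$.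
   Context: The intersection poset $\mathcal L(\mathcal A)$ of a hyperplane arrangement $\mathcal A$ is the set of all nonempty intersections of subsets of hyperplanes of $\mathcal A$ (including the whole space as the empty intersection), ordered by reverse inclusion. $\Pi_{N}$ denotes the lattice of set partitions of $[N]=\{1,\dots,N\}$ ordered by refinement (coarser partitions are larger). For a graph $G$ on vertex set $[N]$, the bond lattice $\Pi_G$ is the subposet of $\Pi_N$ consisting of partitions $B_1|\cdots|B_k$ such that the induced subgraph $G|_{B_i}$ is connected for every $i$. *)

theory Defs
  imports
    "HOL-Library.Disjoint_Sets"
    "Jordan_Normal_Form.Matrix"
    "Graph_Theory.Graph_Theory"
begin

text \<open>
  A poset is given by its reflexive order relation \<open>r\<close>: its set of elements is \<open>Field r\<close>, and
  \<open>(a, b) \<in> r\<close> means that \<open>a\<close> is below \<open>b\<close>. The subposet induced on a set \<open>S\<close> is \<open>Restr r S\<close>.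
  Since the relations are reflexive, two posets are equal (same elements, same order) iff their
  relations are equal. The isomorphism predicate of Main, \<^const>\<open>BNF_Wellorder_Embedding.iso\<close>,
  is phrased through initial segments for well-orders, hence the following definition.
\<close>

definition poset_iso :: "'a rel \<Rightarrow> 'b rel \<Rightarrow> bool" where
  "poset_iso r s \<longleftrightarrow>
     (\<exists>f. bij_betw f (Field r) (Field s) \<and>
          (\<forall>a\<in>Field r. \<forall>b\<in>Field r. (a, b) \<in> r \<longleftrightarrow> (f a, f b) \<in> s))"


section \<open>Intersection posets of hyperplane arrangements\<close>

text \<open>An arrangement is a set \<open>\<A>\<close> of hyperplanes in the ambient space \<open>V\<close>. The factor
  \<open>V\<close> only matters for the empty subset of \<open>\<A>\<close>, whose intersection is \<open>V\<close>.\<close>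

definition intersections :: "'a set \<Rightarrow> 'a set set \<Rightarrow> 'a set set" where
  "intersections V \<A> = {X. X \<noteq> {} \<and> (\<exists>\<B>\<subseteq>\<A>. X = V \<inter> \<Inter>\<B>)}"

definition intersection_poset :: "'a set \<Rightarrow> 'a set set \<Rightarrow> 'a set rel" where
  "intersection_poset V \<A> =
     {(X, Y). X \<in> intersections V \<A> \<and> Y \<in> intersections V \<A> \<and> Y \<subseteq> X}"

text \<open>Coordinates \<open>(x\<^sub>1, \<dots>, x\<^bsub>n+1\<^esub>, y\<^sub>1, \<dots>, y\<^bsub>n+1\<^esub>)\<close> of a vector of dimension \<open>2n + 2\<close>; the
  entries of a vector are numbered from 0, so \<open>x\<^sub>i\<close> has index \<open>i - 1\<close> and \<open>y\<^sub>i\<close> has index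
  \<open>(n + 1) + (i - 1)\<close>.\<close>

definition x_coord :: "real vec \<Rightarrow> nat \<Rightarrow> real" where
  "x_coord v i = v $ (i - 1)"

definition y_coord :: "nat \<Rightarrow> real vec \<Rightarrow> nat \<Rightarrow> real" where
  "y_coord n v i = v $ ((n + 1) + (i - 1))"

text \<open>This is \<open>\<H>\<^bsub>2n-1\<^esub>\<close>; the parameter is \<open>n\<close>, not \<open>2n - 1\<close>.\<close>

definition arrangement_H :: "nat \<Rightarrow> real vec set set" where
  "arrangement_H n =
     {{v \<in> carrier_vec (2 * n + 2). x_coord v i - x_coord v j = y_coord n v i} | i j.
        1 \<le> i \<and> i < j \<and> j \<le> n + 1}"


section \<open>Partition lattices and bond lattices\<close>

definition partition_lattice :: "'a set \<Rightarrow> 'a set set rel" where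
  "partition_lattice A = {(P, Q). refines A P Q}"

text \<open>Simple graphs are instances of \<^locale>\<open>pair_graph\<close>: each edge is represented by its two
  opposite arcs.\<close>

definition bond_lattice :: "'a pair_pre_digraph \<Rightarrow> 'a set set rel" where
  "bond_lattice G =
     Restr (partition_lattice (pverts G))
       {P. \<forall>B\<in>P. Digraph_Component.connected (induce_subgraph (with_proj G) B)}"

text \<open>This is \<open>\<Gamma>\<^bsub>2n\<^esub>\<close>; the parameter is \<open>n\<close>, not \<open>2n\<close>.\<close>

definition graph_Gamma :: "nat \<Rightarrow> nat pair_pre_digraph" where
  "graph_Gamma n =
     \<lparr> pverts = {2 * i - 1 | i. 1 \<le> i \<and> i \<le> n} \<union> {2 * j | j. 1 \<le> j \<and> j \<le> n},
       parcs = (let E = {(2 * i - 1, 2 * j) | i j. 1 \<le> i \<and> i \<le> j \<and> j \<le> n} in E \<union> E\<inverse>) \<rparr>"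


section \<open>Basic facts\<close>

lemma Field_intersection_poset: "Field (intersection_poset V \<A>) = intersections V \<A>"
  by (auto simp: Field_def intersection_poset_def)

lemma partial_order_intersection_poset:
  "partial_order_on (intersections V \<A>) (intersection_poset V \<A>)"
  by (auto simp: order_on_defs refl_on_def trans_def antisym_def intersection_poset_def)

lemma Field_partition_lattice: "Field (partition_lattice A) = {P. partition_on A P}"
  by (auto simp: Field_def partition_lattice_def refines_def)

lemma partial_order_partition_lattice:
  "partial_order_on {P. partition_on A P} (partition_lattice A)"
  by (auto simp: order_on_defs refl_on_def trans_def antisym_def partition_lattice_def
      intro: refines_refl refines_trans dest: refines_asym)
    (auto simp: refines_def)

lemma Field_bond_lattice:
  "Field (bond_lattice G) =
     {P. partition_on (pverts G) P \<and>
         (\<forall>B\<in>P. Digraph_Component.connected (induce_subgraph (with_proj G) B))}"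
  by (auto simp: Field_def bond_lattice_def partition_lattice_def refines_def)

lemma pverts_graph_Gamma: "pverts (graph_Gamma n) = {1..2 * n}"
proof -
  have "k \<in> pverts (graph_Gamma n)" if "k \<in> {1..2 * n}" for k
  proof (cases "even k")
    case True
    with that show ?thesis by (auto simp: graph_Gamma_def elim!: evenE)
  next
    case False
    then obtain m where "k = 2 * m + 1" by (auto elim: oddE)
    with that have "k = 2 * (m + 1) - 1" "1 \<le> m + 1" "m + 1 \<le> n" by auto
    then show ?thesis unfolding graph_Gamma_def by force
  qed
  then have "{1..2 * n} \<subseteq> pverts (graph_Gamma n)" by blast
  moreover have "pverts (graph_Gamma n) \<subseteq> {1..2 * n}" by (auto simp: graph_Gamma_def)
  ultimately show ?thesis by (rule equalityI[rotated])
qed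

lemma pair_graph_Gamma: "pair_graph (graph_Gamma n)"
proof -
  have arcs: "parcs (graph_Gamma n) \<subseteq> {1..2 * n} \<times> {1..2 * n}"
    by (auto simp: graph_Gamma_def Let_def)
  have "finite (parcs (graph_Gamma n))"
    using arcs by (rule finite_subset) simp
  moreover have "2 * i - 1 \<noteq> 2 * j" if "1 \<le> i" for i j :: nat
    using that by presburger
  then have "fst e \<noteq> snd e" if "e \<in> parcs (graph_Gamma n)" for e
    using that by (fastforce simp: graph_Gamma_def Let_def)
  moreover have "symmetric (with_proj (graph_Gamma n))"
    by (auto simp: symmetric_def graph_Gamma_def Let_def sym_def)
  ultimately show ?thesis
    using arcs by unfold_locales (auto simp: pverts_graph_Gamma)
qed

end

theory Submission
  imports Defs
begin

text \<open>
  In the coordinates \<open>w\<^bsub>2i-1\<^esub> = x\<^sub>i - y\<^sub>i\<close> and \<open>w\<^bsub>2j\<^esub> = x\<^bsub>j+1\<^esub>\<close> the hyperplane \<open>x\<^sub>i - x\<^bsub>j+1\<^esub> = y\<^sub>i\<close>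
  reads \<open>w\<^bsub>2i-1\<^esub> = w\<^bsub>2j\<^esub>\<close>, so \<open>\<H>\<^bsub>2n-1\<^esub>\<close> is the graphic arrangement of \<open>\<Gamma>\<^bsub>2n\<^esub>\<close> (times an inessential
  factor), and the flats of a graphic arrangement correspond to the partitions of the vertex set
  into connected blocks: a generic point of a flat determines the blocks as its level sets. In
  \<open>\<Gamma>\<^bsub>2n\<^esub>\<close> an odd vertex is adjacent to precisely the larger even ones. Hence an even minimum
  or an odd maximum of a block is isolated in it; conversely, an odd minimum is adjacent to all
  even vertices of the block and an even maximum to all odd ones, which makes the block connected.
\<close>

section \<open>Order isomorphisms and partitions\<close>

text \<open>Injectivity is automatic: if \<open>f a = f b\<close>, reflexivity of \<open>s\<close>
  relates the two images both ways, so \<open>a\<close> and \<open>b\<close> lie below each other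
  and antisymmetry of \<open>r\<close> identifies them.\<close>

lemma poset_isoI:
  assumes surj: "f ` Field r = Field s"
    and mono: "\<And>a b. a \<in> Field r \<Longrightarrow> b \<in> Field r \<Longrightarrow> (a, b) \<in> r \<longleftrightarrow> (f a, f b) \<in> s"
    and refl: "refl_on (Field s) s" and antisym: "antisym r"
  shows "poset_iso r s"
proof -
  have "inj_on f (Field r)"
    using mono refl antisym surj by (intro inj_onI) (metis antisymD imageI refl_onD)
  then show ?thesis
    using surj mono unfolding poset_iso_def bij_betw_def by blast
qed

lemma poset_iso_sym:
  assumes "poset_iso r s"
  shows "poset_iso s r"
proof -
  from assms obtain f where f: "bij_betw f (Field r) (Field s)"
    and mono: "\<forall>a\<in>Field r. \<forall>b\<in>Field r. (a, b) \<in> r \<longleftrightarrow> (f a, f b) \<in> s"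
    unfolding poset_iso_def by blast
  let ?g = "inv_into (Field r) f"
  have g: "bij_betw ?g (Field s) (Field r)"
    by (rule bij_betw_inv_into[OF f])
  moreover have "(a, b) \<in> s \<longleftrightarrow> (?g a, ?g b) \<in> r" if "a \<in> Field s" "b \<in> Field s" for a b
    using that mono bij_betw_apply[OF g] bij_betw_inv_into_right[OF f] by metis
  ultimately show ?thesis
    unfolding poset_iso_def by blast
qed

lemma partition_on_eq_block:
  assumes "partition_on A P" "B \<in> P" "C \<in> P" "a \<in> B" "a \<in> C"
  shows "B = C"
  using disjointD[OF partition_onD2[OF assms(1)] assms(2,3)] assms(4,5) by blast

text \<open>Fix one element \<open>a\<close> of a block of \<open>P\<close>. As blocks of
  \<open>Q\<close> are disjoint, the block of \<open>Q\<close> shared by \<open>a\<close> and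
  \<open>b\<close> is the same for every \<open>b\<close>.\<close>

lemma refinesI_related:
  assumes P: "partition_on A P" and Q: "partition_on A Q"
    and rel: "\<And>B a b. B \<in> P \<Longrightarrow> a \<in> B \<Longrightarrow> b \<in> B \<Longrightarrow> \<exists>C\<in>Q. a \<in> C \<and> b \<in> C"
  shows "refines A P Q"
  unfolding refines_def
proof (intro conjI ballI P Q)
  fix B assume B: "B \<in> P"
  then obtain a where a: "a \<in> B"
    using partition_onD3[OF P] by (metis all_not_in_conv)
  then obtain C where C: "C \<in> Q" "a \<in> C"
    using rel[OF B] by blast
  have "b \<in> C" if "b \<in> B" for b
    using rel[OF B a that] partition_on_eq_block[OF Q] C by blast
  with C show "\<exists>C\<in>Q. B \<subseteq> C" by blast
qed

section \<open>Connected blocks and reachability\<close>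

text \<open>Symmetric arcs are unchanged by the symmetric closure, and \<open>rtrancl_on B\<close>
  already confines walks to \<open>B\<close>, so cutting the arcs down to \<open>B\<close> changes
  nothing.\<close>

lemma connected_induce_subgraph_iff:
  assumes "sym (parcs G)"
  shows "Digraph_Component.connected (induce_subgraph (with_proj G) B) \<longleftrightarrow>
    B \<noteq> {} \<and> (\<forall>u\<in>B. \<forall>v\<in>B. (u, v) \<in> rtrancl_on B (parcs G))"
proof -
  have "symcl (arcs_ends (induce_subgraph (with_proj G) B)) = parcs G \<inter> B \<times> B"
    using assms by (force simp: symcl_def arcs_ends_conv sym_def image_iff)
  moreover have "(u, v) \<in> rtrancl_on B (parcs G \<inter> B \<times> B) \<longleftrightarrow> (u, v) \<in> rtrancl_on B (parcs G)" for u v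
  proof
    assume "(u, v) \<in> rtrancl_on B (parcs G \<inter> B \<times> B)"
    then show "(u, v) \<in> rtrancl_on B (parcs G)"
      by (rule rtrancl_on_mono[rotated 2]) auto
  next
    assume "(u, v) \<in> rtrancl_on B (parcs G)"
    then show "(u, v) \<in> rtrancl_on B (parcs G \<inter> B \<times> B)"
      by (induction rule: rtrancl_on_induct) (auto intro: rtrancl_on_into_rtrancl_on)
  qed
  ultimately show ?thesis
    by (simp add: connected_conv)
qed

lemma equiv_rtrancl_on:
  assumes "sym r"
  shows "equiv A (rtrancl_on A r)"
proof (rule equivI)
  show "rtrancl_on A r \<subseteq> A \<times> A"
    by (auto dest: in_rtrancl_on_in_F)
  show "refl_on A (rtrancl_on A r)"
    by (auto simp: refl_on_def)
  show "sym (rtrancl_on A r)"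
    by (rule rtrancl_on_sym[OF assms])
  show "trans (rtrancl_on A r)"
    by (auto intro: transI rtrancl_on_trans)
qed

text \<open>A walk starting at \<open>u\<close> never leaves the class of \<open>u\<close>, because
  every vertex it visits is itself reachable from \<open>u\<close>.\<close>

lemma rtrancl_on_quotient_block:
  assumes eq: "equiv A (rtrancl_on A r)" and B: "B \<in> A // rtrancl_on A r"
    and u: "u \<in> B" and v: "v \<in> B"
  shows "(u, v) \<in> rtrancl_on B r"
proof -
  have "(u, v) \<in> rtrancl_on A r"
    using eq B u v by (meson in_quotient_imp_in_rel insert_subset empty_subsetI)
  then show ?thesis
  proof (induction rule: rtrancl_on_induct)
    case base
    show ?case using u by simp
  next
    case (step y z)
    have "(u, z) \<in> rtrancl_on A r"
      using step.hyps by (blast intro: rtrancl_on_into_rtrancl_on)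
    then have "z \<in> B"
      using in_quotient_imp_closed[OF eq B u] by blast
    with step show ?case by (blast intro: rtrancl_on_into_rtrancl_on)
  qed
qed

section \<open>Graphic arrangements and bond lattices\<close>

text \<open>
  The family \<open>w\<close> are the coordinates indexed by vertices. Surjectivity onto all families is a
  weaker requirement than being a coordinate system: it leaves room for further coordinates.
\<close>

theorem poset_iso_graphic_arrangement:
  fixes G :: "'a pair_pre_digraph" and w :: "'v \<Rightarrow> 'a \<Rightarrow> 'k::zero_neq_one"
  assumes wf: "parcs G \<subseteq> pverts G \<times> pverts G" and sym: "sym (parcs G)"
    and surj: "\<And>g. \<exists>v\<in>V. \<forall>a\<in>pverts G. w v a = g a"
  shows "poset_iso (intersection_poset V {{v \<in> V. w v a = w v b} | a b. (a, b) \<in> parcs G})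
           (bond_lattice G)"
    (is "poset_iso (intersection_poset V ?\<A>) _")
\<comment> \<open>The isomorphism is built from partitions to flats, the direction with an explicit
  formula.\<close>
proof (rule poset_iso_sym, rule poset_isoI)
  define flat where "flat P = {v \<in> V. \<forall>B\<in>P. \<forall>a\<in>B. \<forall>b\<in>B. w v a = w v b}" for P
  note conn_iff = connected_induce_subgraph_iff[OF sym]
  have bond: "partition_on (pverts G) P"
    "\<And>B u v. B \<in> P \<Longrightarrow> u \<in> B \<Longrightarrow> v \<in> B \<Longrightarrow> (u, v) \<in> rtrancl_on B (parcs G)"
    if "P \<in> Field (bond_lattice G)" for P
    using that by (auto simp: Field_bond_lattice conn_iff)

  have flat_in: "flat P \<in> intersections V ?\<A>" if P: "P \<in> Field (bond_lattice G)" for P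
  proof -
    \<comment> \<open>Only arcs inside a block are imposed as equations; connectedness propagates
      them along walks to the whole block.\<close>
    let ?\<B> = "{{v \<in> V. w v a = w v b} | a b. (a, b) \<in> parcs G \<and> (\<exists>B\<in>P. a \<in> B \<and> b \<in> B)}"
    have const: "w v a = w v b"
      if v: "v \<in> \<Inter>?\<B>" and B: "B \<in> P" and ab: "a \<in> B" "b \<in> B" for v a b B
      using bond(2)[OF P B ab]
    proof (induction rule: rtrancl_on_induct)
      case (step y z)
      then have "{v \<in> V. w v y = w v z} \<in> ?\<B>" using B by blast
      with v have "w v y = w v z" by blast
      with step show ?case by simp
    qed simp
    have "flat P = V \<inter> \<Inter>?\<B>"
    proof (intro equalityI subsetI)
      fix v assume v: "v \<in> flat P"
      then have "v \<in> H" if "H \<in> ?\<B>" for H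
        using that unfolding flat_def by auto
      with v show "v \<in> V \<inter> \<Inter>?\<B>"
        unfolding flat_def by simp
    next
      fix v assume v: "v \<in> V \<inter> \<Inter>?\<B>"
      show "v \<in> flat P"
        unfolding flat_def using IntD1[OF v] const[OF IntD2[OF v]] by blast
    qed
    moreover have "?\<B> \<subseteq> ?\<A>" by blast
    moreover have "flat P \<noteq> {}"
    proof -
      \<comment> \<open>A point whose vertex coordinates all vanish lies on every flat.\<close>
      obtain v where v: "v \<in> V" "\<forall>a\<in>pverts G. w v a = 0"
        using surj[of "\<lambda>_. 0"] by blast
      moreover have "B \<subseteq> pverts G" if "B \<in> P" for B
        using partition_onD1[OF bond(1)[OF P]] that by blast
      ultimately have "v \<in> flat P"
        unfolding flat_def by (auto simp: subset_iff)
      then show ?thesis by blast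
    qed
    ultimately show ?thesis unfolding intersections_def by blast
  qed

  have in_flat: "X \<in> flat ` Field (bond_lattice G)" if X: "X \<in> intersections V ?\<A>" for X
  proof -
    obtain \<B> where \<B>: "\<B> \<subseteq> ?\<A>" and X: "X = V \<inter> \<Inter>\<B>"
      using X unfolding intersections_def by blast
    \<comment> \<open>Conversely, the hyperplanes in \<open>\<B>\<close> select a subgraph
      \<open>F\<close>, and the blocks of the partition are its connected components.\<close>
    define F where "F = {(a, b) \<in> parcs G. {v \<in> V. w v a = w v b} \<in> \<B>}"
    define R where "R = rtrancl_on (pverts G) F"
    define P where "P = pverts G // R"
    have "sym F"
      using sym unfolding F_def sym_def by (auto simp: eq_commute)
    then have eq: "equiv (pverts G) R"
      unfolding R_def by (rule equiv_rtrancl_on)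
    then have part: "partition_on (pverts G) P"
      unfolding P_def by (rule partition_on_quotient)
    have "(u, v) \<in> rtrancl_on B (parcs G)" if B: "B \<in> P" and uv: "u \<in> B" "v \<in> B" for B u v
    proof -
      have "(u, v) \<in> rtrancl_on B F"
        by (rule rtrancl_on_quotient_block[OF eq[unfolded R_def] B[unfolded P_def R_def] uv])
      then show ?thesis
        by (rule rtrancl_on_mono[rotated 2]) (auto simp: F_def)
    qed
    then have "P \<in> Field (bond_lattice G)"
      using part partition_onD3[OF part] by (auto simp: Field_bond_lattice conn_iff)
    moreover have "X = flat P"
    proof (intro equalityI subsetI)
      fix v assume v: "v \<in> X"
      have "w v a = w v b" if "(a, b) \<in> R" for a b
        using that unfolding R_def
      proof (induction rule: rtrancl_on_induct)
        case (step y z)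
        with v have "w v y = w v z" unfolding X F_def by blast
        with step show ?case by simp
      qed simp
      moreover have "(a, b) \<in> R" if "B \<in> P" "a \<in> B" "b \<in> B" for a b B
        using eq that unfolding P_def by (meson in_quotient_imp_in_rel insert_subset empty_subsetI)
      ultimately show "v \<in> flat P"
        using v unfolding flat_def X by blast
    next
      fix v assume v: "v \<in> flat P"
      have "v \<in> H" if H: "H \<in> \<B>" for H
      proof -
        obtain a b where ab: "(a, b) \<in> parcs G" and H_eq: "H = {v \<in> V. w v a = w v b}"
          using \<B> H by blast
        then have "(a, b) \<in> F" "a \<in> pverts G" "b \<in> pverts G"
          using H wf unfolding F_def by blast+
        then have "(a, b) \<in> R"
          unfolding R_def by (blast intro: rtrancl_on_into_rtrancl_on)
        then have "a \<in> R `` {a}" "b \<in> R `` {a}" "R `` {a} \<in> P"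
          using equiv_class_self[OF eq] quotientI[of a _ R] \<open>a \<in> pverts G\<close>
          unfolding P_def by blast+
        with v show ?thesis unfolding flat_def H_eq by blast
      qed
      with v show "v \<in> X" unfolding X flat_def by blast
    qed
    ultimately show ?thesis by blast
  qed

  show "flat ` Field (bond_lattice G) = Field (intersection_poset V ?\<A>)"
    using flat_in in_flat unfolding Field_intersection_poset by blast

  fix P Q assume P: "P \<in> Field (bond_lattice G)" and Q: "Q \<in> Field (bond_lattice G)"
  have "refines (pverts G) P Q \<longleftrightarrow> flat Q \<subseteq> flat P"
  proof
    assume ref: "refines (pverts G) P Q"
    show "flat Q \<subseteq> flat P"
    proof
      fix v assume v: "v \<in> flat Q"
      have "w v a = w v b" if B: "B \<in> P" and ab: "a \<in> B" "b \<in> B" for B a b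
      proof -
        obtain C where "C \<in> Q" "B \<subseteq> C"
          using ref B unfolding refines_def by blast
        with v ab show ?thesis
          unfolding flat_def by (simp add: subset_iff)
      qed
      with v show "v \<in> flat P"
        unfolding flat_def by blast
    qed
  next
    assume sub: "flat Q \<subseteq> flat P"
    show "refines (pverts G) P Q"
    proof (rule refinesI_related[OF bond(1)[OF P] bond(1)[OF Q]])
      fix B a b assume B: "B \<in> P" and a: "a \<in> B" and b: "b \<in> B"
      then have vert: "a \<in> pverts G" "b \<in> pverts G"
        using partition_onD1[OF bond(1)[OF P]] by blast+
      then obtain C where C: "C \<in> Q" "a \<in> C"
        using partition_onD1[OF bond(1)[OF Q]] by blast
      \<comment> \<open>The indicator of the block \<open>C\<close> is constant on every block of
        \<open>Q\<close>, hence also on the blocks of \<open>P\<close>; since 0 and 1 differ, this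
        forces \<open>b\<close> into \<open>C\<close>.\<close>
      obtain v where v: "v \<in> V" "\<forall>c\<in>pverts G. w v c = of_bool (c \<in> C)"
        using surj[of "\<lambda>c. of_bool (c \<in> C)"] by blast
      have "w v c = w v d" if "D \<in> Q" "c \<in> D" "d \<in> D" for c d D
      proof -
        have "c \<in> C \<longleftrightarrow> d \<in> C"
          using partition_on_eq_block[OF bond(1)[OF Q]] C(1) that by blast
        moreover have "c \<in> pverts G" "d \<in> pverts G"
          using partition_onD1[OF bond(1)[OF Q]] that by blast+
        ultimately show ?thesis using v by simp
      qed
      then have "v \<in> flat Q" using v unfolding flat_def by blast
      then have "w v a = w v b" using sub B a b unfolding flat_def by blast
      then have "b \<in> C" using v vert C by (simp add: of_bool_def split: if_splits)
      then show "\<exists>C\<in>Q. a \<in> C \<and> b \<in> C" using C by blast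
    qed
  qed
  then show "(P, Q) \<in> bond_lattice G \<longleftrightarrow> (flat P, flat Q) \<in> intersection_poset V ?\<A>"
    using P[unfolded Field_bond_lattice] Q[unfolded Field_bond_lattice] flat_in[OF P] flat_in[OF Q]
    by (simp add: bond_lattice_def partition_lattice_def intersection_poset_def)
next
  show "refl_on (Field (intersection_poset V ?\<A>)) (intersection_poset V ?\<A>)"
    using partial_order_intersection_poset[of V ?\<A>]
    by (simp add: order_on_defs Field_intersection_poset)
  show "antisym (bond_lattice G)"
    by (auto simp: antisym_def bond_lattice_def partition_lattice_def dest: refines_asym)
qed

section \<open>The graph \<Gamma>_{2n} and its connected blocks\<close>

text \<open>For i \<ge> 1, the condition i \<le> j amounts to 2i-1 < 2j, so adjacency depends only
  on parity and order of the labels.\<close>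

lemma graph_Gamma_arc_iff:
  "(a, b) \<in> parcs (graph_Gamma n) \<longleftrightarrow>
     a \<in> {1..2 * n} \<and> b \<in> {1..2 * n} \<and> (odd a \<and> even b \<and> a < b \<or> odd b \<and> even a \<and> b < a)"
proof -
  have E: "(\<exists>i j. a = 2 * i - 1 \<and> b = 2 * j \<and> 1 \<le> i \<and> i \<le> j \<and> j \<le> n) \<longleftrightarrow>
      1 \<le> a \<and> b \<le> 2 * n \<and> odd a \<and> even b \<and> a < b" for a b :: nat
  proof
    assume "1 \<le> a \<and> b \<le> 2 * n \<and> odd a \<and> even b \<and> a < b"
    then show "\<exists>i j. a = 2 * i - 1 \<and> b = 2 * j \<and> 1 \<le> i \<and> i \<le> j \<and> j \<le> n"
      by (intro exI[of _ "(a + 1) div 2"] exI[of _ "b div 2"]) (auto elim!: oddE evenE)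
  qed auto
  have "(a, b) \<in> parcs (graph_Gamma n) \<longleftrightarrow>
      (\<exists>i j. a = 2 * i - 1 \<and> b = 2 * j \<and> 1 \<le> i \<and> i \<le> j \<and> j \<le> n) \<or>
      (\<exists>i j. b = 2 * i - 1 \<and> a = 2 * j \<and> 1 \<le> i \<and> i \<le> j \<and> j \<le> n)"
    by (simp add: graph_Gamma_def Let_def)
  then show ?thesis
    unfolding E by auto
qed

lemma sym_graph_Gamma: "sym (parcs (graph_Gamma n))"
  by (auto simp: sym_def graph_Gamma_arc_iff)

lemma connected_graph_Gamma_iff:
  assumes B: "B \<subseteq> {1..2 * n}" "B \<noteq> {}"
  shows "Digraph_Component.connected (induce_subgraph (with_proj (graph_Gamma n)) B) \<longleftrightarrow>
    (\<not> is_singleton B \<longrightarrow> odd (Min B) \<and> even (Max B))"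
proof -
  let ?E = "parcs (graph_Gamma n)"
  have fin: "finite B" using B(1) by (rule finite_subset) simp
  then have ends: "Min B \<in> B" "Max B \<in> B" using B(2) by auto
  have "odd (Min B) \<and> even (Max B)"
    if conn: "\<forall>u\<in>B. \<forall>v\<in>B. (u, v) \<in> rtrancl_on B ?E" and ns: "\<not> is_singleton B"
  proof -
    \<comment> \<open>The first arc of a walk in \<open>B\<close> from \<open>u\<close> to another
      vertex provides the neighbour.\<close>
    have nb: "\<exists>c\<in>B. (u, c) \<in> ?E" if u: "u \<in> B" for u
    proof -
      obtain v where "v \<in> B" "v \<noteq> u"
        using ns u is_singletonI'[of B] by blast
      then show ?thesis
        using conn u by (metis converse_rtrancl_on_cases in_rtrancl_on_in_F(1))
    qed
    have "odd (Min B)"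
      using nb[OF ends(1)] fin by (auto simp: graph_Gamma_arc_iff dest: Min_le)
    moreover have "even (Max B)"
      using nb[OF ends(2)] fin by (auto simp: graph_Gamma_arc_iff dest: Max_ge)
    ultimately show ?thesis ..
  qed
  moreover have "(u, v) \<in> rtrancl_on B ?E"
    if par: "odd (Min B)" "even (Max B)" and uv: "u \<in> B" "v \<in> B" for u v
  proof -
    let ?R = "rtrancl_on B ?E"
    have arc: "(a, b) \<in> ?R" "(b, a) \<in> ?R"
      if ab: "a \<in> B" "b \<in> B" and "odd a" "even b" "a \<le> b" for a b
    proof -
      have "a \<in> {1..2 * n}" "b \<in> {1..2 * n}" "a < b"
        using B(1) that by (auto simp: order.strict_iff_order)
      then have "(a, b) \<in> ?E" "(b, a) \<in> ?E"
        using that unfolding graph_Gamma_arc_iff by simp_all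
      then show "(a, b) \<in> ?R" "(b, a) \<in> ?R"
        using ab by (blast intro: rtrancl_on_into_rtrancl_on)+
    qed
    \<comment> \<open>Even vertices are reached from \<open>Min B\<close> by at most one arc, odd
      ones by a detour through \<open>Max B\<close>.\<close>
    have from_Min: "(Min B, a) \<in> ?R" if a: "a \<in> B" for a
    proof (cases "even a")
      case True
      then show ?thesis
        using arc(1)[OF ends(1) a] par(1) fin a by simp
    next
      case False
      have "(Min B, Max B) \<in> ?R"
        using arc(1)[OF ends] par fin ends by simp
      moreover have "(Max B, a) \<in> ?R"
        using arc(2)[OF a ends(2)] False par(2) fin a by simp
      ultimately show ?thesis by (rule rtrancl_on_trans)
    qed
    have "(u, Min B) \<in> ?R"
      using from_Min[OF uv(1)] rtrancl_on_sym[OF sym_graph_Gamma] by (blast dest: symD)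
    then show ?thesis
      using from_Min[OF uv(2)] by (rule rtrancl_on_trans)
  qed
  moreover have "(u, v) \<in> rtrancl_on B ?E" if "is_singleton B" "u \<in> B" "v \<in> B" for u v
    using that by (auto elim!: is_singletonE)
  ultimately show ?thesis
    using B(2) unfolding connected_induce_subgraph_iff[OF sym_graph_Gamma] by blast
qed

lemma bond_lattice_graph_Gamma:
  "bond_lattice (graph_Gamma n) =
     Restr (partition_lattice {1..2 * n})
       {P. \<forall>B\<in>P. \<not> is_singleton B \<longrightarrow> odd (Min B) \<and> even (Max B)}"
proof -
  have "(\<forall>B\<in>P. Digraph_Component.connected (induce_subgraph (with_proj (graph_Gamma n)) B)) \<longleftrightarrow>
      (\<forall>B\<in>P. \<not> is_singleton B \<longrightarrow> odd (Min B) \<and> even (Max B))"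
    if P: "partition_on {1..2 * n} P" for P
  proof (intro ball_cong refl connected_graph_Gamma_iff)
    fix B assume "B \<in> P"
    then show "B \<subseteq> {1..2 * n}" "B \<noteq> {}"
      using partition_onD1[OF P] partition_onD3[OF P] by auto
  qed
  then show ?thesis
    unfolding bond_lattice_def partition_lattice_def refines_def pverts_graph_Gamma by auto
qed

section \<open>The arrangement in vertex coordinates\<close>

text \<open>These are the coordinates w_k: k = 2i-1 gives i = (k+1)/2, and k = 2j gives the shifted
  index j+1 of x.\<close>

definition Gamma_coord :: "nat \<Rightarrow> real vec \<Rightarrow> nat \<Rightarrow> real" where
  "Gamma_coord n v k =
     (if odd k then x_coord v ((k + 1) div 2) - y_coord n v ((k + 1) div 2)
      else x_coord v (k div 2 + 1))"

lemma Gamma_coord_odd: "1 \<le> i \<Longrightarrow> Gamma_coord n v (2 * i - 1) = x_coord v i - y_coord n v i"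
  by (cases i) (auto simp: Gamma_coord_def)

lemma Gamma_coord_even: "Gamma_coord n v (2 * j) = x_coord v (Suc j)"
  by (simp add: Gamma_coord_def)

lemma Gamma_coord_surj:
  "\<exists>v\<in>carrier_vec (2 * n + 2). \<forall>k\<in>pverts (graph_Gamma n). Gamma_coord n v k = g k"
proof
  \<comment> \<open>Entry m \<le> n is x_{m+1}, so x_{j+1} = g(2j). Entry m = n+i is y_i, solved
    from x_i - y_i = g(2i-1) with x_i = g(2(i-1)). For i = 1 this uses \<open>g 0\<close>, an
    arbitrary value as 0 is not a vertex.\<close>
  let ?v = "vec (2 * n + 2) (\<lambda>m. if m \<le> n then g (2 * m) else g (2 * (m - n - 1)) - g (2 * (m - n) - 1))"
  show "?v \<in> carrier_vec (2 * n + 2)" by simp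
  have "Gamma_coord n ?v (2 * i - 1) = g (2 * i - 1)" if "1 \<le> i" "i \<le> n" for i
    using that unfolding Gamma_coord_odd[OF that(1)] x_coord_def y_coord_def by auto
  moreover have "Gamma_coord n ?v (2 * j) = g (2 * j)" if "j \<le> n" for j
    using that unfolding Gamma_coord_even x_coord_def by simp
  ultimately show "\<forall>k\<in>pverts (graph_Gamma n). Gamma_coord n ?v k = g k"
    by (auto simp: graph_Gamma_def)
qed

lemma arrangement_H_graphic:
  "arrangement_H n =
     {{v \<in> carrier_vec (2 * n + 2). Gamma_coord n v a = Gamma_coord n v b} | a b.
        (a, b) \<in> parcs (graph_Gamma n)}" (is "_ = ?R")
proof -
  let ?H = "\<lambda>a b. {v \<in> carrier_vec (2 * n + 2). Gamma_coord n v a = Gamma_coord n v b}"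
  have eq: "{v \<in> carrier_vec (2 * n + 2). x_coord v i - x_coord v (Suc j) = y_coord n v i} =
      ?H (2 * i - 1) (2 * j)" if "1 \<le> i" for i j
    unfolding Gamma_coord_odd[OF that] Gamma_coord_even by auto
  \<comment> \<open>Replacing j by j+1 turns i < j \<le> n+1 into i \<le> j \<le> n.\<close>
  have "arrangement_H n = {?H (2 * i - 1) (2 * j) | i j. 1 \<le> i \<and> i \<le> j \<and> j \<le> n}"
  proof (intro equalityI subsetI)
    fix X assume "X \<in> arrangement_H n"
    then obtain i j where "1 \<le> i" "i < j" "j \<le> n + 1"
      and X: "X = {v \<in> carrier_vec (2 * n + 2). x_coord v i - x_coord v j = y_coord n v i}"
      unfolding arrangement_H_def by blast
    moreover from this have "X = ?H (2 * i - 1) (2 * (j - 1))"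
      using eq[of i "j - 1"] by simp
    moreover have "i \<le> j - 1" "j - 1 \<le> n" using calculation by auto
    ultimately show "X \<in> {?H (2 * i - 1) (2 * j) | i j. 1 \<le> i \<and> i \<le> j \<and> j \<le> n}" by blast
  next
    fix X assume "X \<in> {?H (2 * i - 1) (2 * j) | i j. 1 \<le> i \<and> i \<le> j \<and> j \<le> n}"
    then obtain i j where ij: "1 \<le> i" "i < Suc j" "Suc j \<le> n + 1" and "X = ?H (2 * i - 1) (2 * j)"
      by (auto simp only: mem_Collect_eq less_Suc_eq_le Suc_eq_plus1[symmetric] Suc_le_mono)
    then show "X \<in> arrangement_H n"
      unfolding arrangement_H_def eq[OF ij(1), symmetric] by blast
  qed
  also have "\<dots> = ?R"
  proof -
    \<comment> \<open>The two opposite arcs of an edge define the same hyperplane.\<close>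
    have "?H a b = ?H b a" for a b by (auto simp: eq_commute)
    then show ?thesis
      unfolding graph_Gamma_def Let_def by (simp, blast)
  qed
  finally show ?thesis .
qed

theorem theorem3p1:
  fixes n :: nat
  assumes "n \<ge> 1"
  shows "poset_iso (intersection_poset (carrier_vec (2 * n + 2)) (arrangement_H n))
           (bond_lattice (graph_Gamma n)) \<and>
         bond_lattice (graph_Gamma n) =
           Restr (partition_lattice {1..2 * n})
             {P. \<forall>B\<in>P. \<not> is_singleton B \<longrightarrow> odd (Min B) \<and> even (Max B)}"
proof
  show "poset_iso (intersection_poset (carrier_vec (2 * n + 2)) (arrangement_H n))
      (bond_lattice (graph_Gamma n))"
    unfolding arrangement_H_graphic
    by (rule poset_iso_graphic_arrangement[OF _ sym_graph_Gamma Gamma_coord_surj])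
      (auto simp: graph_Gamma_arc_iff pverts_graph_Gamma)
qed (rule bond_lattice_graph_Gamma)

end
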